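(* For every real $0\le\alpha\le\frac{1}{3}$ and every real $\varepsilon>0$, for every sufficiently large integer $n$ there exists a symmetric complete sum-free set $S\subseteq\mathbb{Z}_n$ whose size satisfies \[ \alpha-\varepsilon\le\frac{|S|}{n}\le\alpha+\varepsilon.\]
   Context: $\mathbb{Z}_n$ is the cyclic group of integers modulo $n$. For a subset $S$ of an abelian additive group $G$, $S+S=\{x+y \mid x,y\in S\}$. The set $S$ is symmetric if $x\in S$ implies $-x\in S$, complete if every $z\in G\setminus S$ satisfies $z\in S+S$, and sum-free if $S\cap(S+S)=\emptyset$. How large $n$ must be may depend on $\alpha$ and $\varepsilon$. *)

theory Defs
  imports Complex_Main "HOL-Algebra.Elementary_Groups"
begin

text \<open>
  HOL-Algebra writes groups multiplicatively, so for an abelian group \<open>G\<close> written additively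
  in the mathematics, the sumset \<open>S + S\<close> is \<open>S <#>\<^bsub>G\<^esub> S\<close> and the negative of \<open>x\<close> is
  \<open>inv\<^bsub>G\<^esub> x\<close>. The cyclic group of integers modulo \<open>n\<close> is \<open>integer_mod_group n\<close>, with carrier
  \<open>{0..<int n}\<close> for \<open>n > 0\<close>. The definitions are meant for \<open>S \<subseteq> carrier G\<close>.
\<close>

definition symmetric_in :: "('a, 'b) monoid_scheme \<Rightarrow> 'a set \<Rightarrow> bool"
  where "symmetric_in G S \<longleftrightarrow> (\<forall>x\<in>S. inv\<^bsub>G\<^esub> x \<in> S)"

definition complete_in :: "('a, 'b) monoid_scheme \<Rightarrow> 'a set \<Rightarrow> bool"
  where "complete_in G S \<longleftrightarrow> (\<forall>z \<in> carrier G - S. z \<in> S <#>\<^bsub>G\<^esub> S)"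

definition sum_free_in :: "('a, 'b) monoid_scheme \<Rightarrow> 'a set \<Rightarrow> bool"
  where "sum_free_in G S \<longleftrightarrow> S \<inter> (S <#>\<^bsub>G\<^esub> S) = {}"

end

theory Submission
  imports Defs
begin

text \<open>
  A subset of \<open>\<int>\<^sub>n\<close> is handled as the \<open>n\<close>-periodic set of integers lying above it. Being symmetric,
  sum-free or complete then refers to the addition of integers alone, so that sets with different
  periods can be combined.

  A symmetric sum-free set that cannot be enlarged by a pair \<open>\<plusminus>z\<close> is not always complete: the
  enlargement may also fail because \<open>2z\<close> lies in the set, or because \<open>3z = 0\<close>. Both obstacles vanish
  when \<open>2z\<close> is a sum of two elements of the set. So it suffices to find a symmetric sum-free \<open>seed\<close>
  of the right size for which the uncovered elements, those neither in the seed nor a sum of two of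
  its elements, are few and have their doubles covered by sums (\<open>complete_extension\<close>).

  Such a seed is built from an arbitrary complete symmetric sum-free set \<open>C\<close> of a fixed period \<open>q\<close>
  prime to 3. Choose \<open>a\<close> with \<open>n/4 < a < n/3\<close>. The seed consists of the full interval
  \<open>(n - 2a, 2a)\<close> around \<open>n/2\<close>, the part of a translate \<open>c + C\<close> in \<open>[a, n - 2a]\<close>, and the mirror image
  of that part. Differences within the full interval, and between it and the second piece, cover
  everything below \<open>a\<close>. Inside \<open>[a, n - 2a]\<close> the relevant sums are \<open>n - x - y\<close> with \<open>x\<close> and \<open>y\<close> in the
  same interval; with \<open>3c \<equiv> n\<close> modulo \<open>q\<close> this operation becomes \<open>(u, v) \<mapsto> - u - v\<close> on residues
  relative to \<open>c\<close>, so that sum-freeness and completeness there are inherited from \<open>C\<close>. Only \<open>O(q)\<close>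
  elements near \<open>\<plusminus>2a\<close> stay uncovered.

  If \<open>C\<close> has density \<open>\<kappa>\<close>, the seed has about \<open>(4a - n) + 2\<kappa>(n - 3a)\<close> elements, which sweeps the
  densities from \<open>\<kappa>/2\<close> to \<open>1/3\<close> as \<open>a/n\<close> runs from \<open>1/4\<close> to \<open>1/3\<close> (\<open>densities_from_set\<close>). In
  particular \<open>C\<close> yields a new complete set of density close to \<open>\<kappa>/2\<close>, whose period may again be taken
  prime to 3. Iterating from the odd integers makes \<open>\<kappa>\<close> arbitrarily small
  (\<open>sparse_complete_sum_free\<close>), and one more application approximates any
  density in \<open>[0, 1/3]\<close>.
\<close>

section \<open>Periodic sets of integers\<close>

definition periodic :: "int \<Rightarrow> int set \<Rightarrow> bool"
  where "periodic n S \<longleftrightarrow> (\<forall>x y. n dvd x - y \<longrightarrow> x \<in> S \<longrightarrow> y \<in> S)"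

definition sumset :: "int set \<Rightarrow> int set"
  where "sumset S = {x + y | x y. x \<in> S \<and> y \<in> S}"

definition sym_sum_free :: "int \<Rightarrow> int set \<Rightarrow> bool"
  where "sym_sum_free n S \<longleftrightarrow> periodic n S \<and> (\<forall>x\<in>S. - x \<in> S) \<and> S \<inter> sumset S = {}"

definition complete_sum_free :: "int \<Rightarrow> int set \<Rightarrow> bool"
  where "complete_sum_free n S \<longleftrightarrow> sym_sum_free n S \<and> S \<union> sumset S = UNIV"

definition density :: "int \<Rightarrow> int set \<Rightarrow> real"
  where "density n S = real (card (S \<inter> {0..<n})) / real_of_int n"

lemma periodicD: "periodic n S \<Longrightarrow> x \<in> S \<Longrightarrow> n dvd x - y \<Longrightarrow> y \<in> S"
  unfolding periodic_def by blast

lemma sumsetI: "x \<in> S \<Longrightarrow> y \<in> S \<Longrightarrow> z = x + y \<Longrightarrow> z \<in> sumset S"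
  unfolding sumset_def by blast

lemma sumset_mono: "S \<subseteq> T \<Longrightarrow> sumset S \<subseteq> sumset T"
  unfolding sumset_def by blast

lemma sumset_uminus:
  assumes "\<forall>x\<in>S. - x \<in> S" and "z \<in> sumset S"
  shows "- z \<in> sumset S"
proof -
  obtain x y where "x \<in> S" "y \<in> S" "z = x + y" using assms(2) unfolding sumset_def by blast
  then show ?thesis using assms(1) by (intro sumsetI[of "- x" S "- y"]) auto
qed

lemma sumset_periodic:
  assumes "periodic n S"
  shows "periodic n (sumset S)"
  unfolding periodic_def
proof (intro allI impI)
  fix u v assume d: "n dvd u - v" and "u \<in> sumset S"
  then obtain x y where xy: "x \<in> S" "y \<in> S" "u = x + y" unfolding sumset_def by blast
  have "v - x \<in> S" by (rule periodicD[OF assms xy(2)]) (use d xy(3) in \<open>simp add: algebra_simps\<close>)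
  then show "v \<in> sumset S" using xy(1) by (intro sumsetI[of x S "v - x"]) auto
qed

text \<open>
  For symmetric sets, sum-freeness is the absence of zero-sum triples, a condition invariant under
  permuting the three elements; the proofs below use it in this form.
\<close>

lemma sum_freeD:
  assumes "sym_sum_free n S" "x \<in> S" "y \<in> S" "w \<in> S"
  shows "x + y + w \<noteq> 0"
proof
  assume "x + y + w = 0"
  then have "- w = x + y" by simp
  then have "- w \<in> sumset S" using assms by (auto intro: sumsetI)
  moreover have "- w \<in> S" using assms unfolding sym_sum_free_def by blast
  ultimately show False using assms(1) unfolding sym_sum_free_def by blast
qed

lemma sym_sum_freeI:
  assumes "periodic n S" "\<And>x. x \<in> S \<Longrightarrow> - x \<in> S"
    and "\<And>x y w. x \<in> S \<Longrightarrow> y \<in> S \<Longrightarrow> w \<in> S \<Longrightarrow> x + y + w \<noteq> 0"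
  shows "sym_sum_free n S"
  unfolding sym_sum_free_def
proof (intro conjI ballI)
  show "S \<inter> sumset S = {}"
  proof (rule ccontr)
    assume "S \<inter> sumset S \<noteq> {}"
    then obtain x y where "x \<in> S" "y \<in> S" "x + y \<in> S" unfolding sumset_def by blast
    then show False using assms(3)[of x y "- (x + y)"] assms(2)[of "x + y"] by simp
  qed
qed (use assms in auto)

lemma complete_nonempty:
  assumes "complete_sum_free n S"
  shows "S \<noteq> {}"
proof
  assume "S = {}"
  then have "S \<union> sumset S = {}" unfolding sumset_def by blast
  then show False using assms unfolding complete_sum_free_def by simp
qed

section \<open>Maximal symmetric sum-free sets\<close>

text \<open>
  A zero-sum triple in the enlarged set is excluded according to how many of its members are new.
  One new member would put \<open>z\<close> into \<open>S + S\<close>. With two, their sum is \<open>\<plusminus>2z\<close> or \<open>0\<close> modulo \<open>n\<close>, hence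
  in \<open>S + S\<close> and not in \<open>S\<close>. With three, the third is minus such a sum, so again \<open>z \<in> S + S\<close>.
\<close>

lemma sum_free_adjoin:
  assumes S: "sym_sum_free n S" and "S \<noteq> {}"
    and z: "z \<notin> sumset S" "2 * z \<in> sumset S"
  shows "sym_sum_free n (S \<union> {x. n dvd x - z \<or> n dvd x + z})" (is "sym_sum_free n (S \<union> ?Z)")
proof (rule sym_sum_freeI)
  have per: "periodic n S" and sym: "\<And>x. x \<in> S \<Longrightarrow> - x \<in> S"
    and dis: "S \<inter> sumset S = {}"
    using S unfolding sym_sum_free_def by auto
  note perS = sumset_periodic[OF per]
  have zero: "0 \<in> sumset S" using \<open>S \<noteq> {}\<close> sym by (force intro: sumsetI)
  have neg: "- u \<in> sumset S \<Longrightarrow> u \<in> sumset S" for u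
    using sumset_uminus[of S "- u"] sym by auto
  show "periodic n (S \<union> ?Z)" unfolding periodic_def
  proof (intro allI impI)
    fix x y assume d: "n dvd x - y" and x: "x \<in> S \<union> ?Z"
    have "n dvd y - z" if "n dvd x - z" using dvd_diff[OF that d] by simp
    moreover have "n dvd y + z" if "n dvd x + z" using dvd_diff[OF that d] by (simp add: add.commute)
    ultimately show "y \<in> S \<union> ?Z" using x periodicD[OF per _ d] by auto
  qed
  show "- x \<in> S \<union> ?Z" if "x \<in> S \<union> ?Z" for x
  proof -
    have "n dvd - x - z" if "n dvd x + z" using that dvd_minus_iff[of n "x + z"] by simp
    moreover have "n dvd - x + z" if "n dvd x - z" using that dvd_minus_iff[of n "x - z"] by simp
    ultimately show ?thesis using that sym by auto
  qed
  have one: False if "x \<in> S" "y \<in> S" "w \<in> ?Z" "x + y + w = 0" for x y w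
  proof -
    have xy: "x + y \<in> sumset S" using that by (auto intro: sumsetI)
    have w: "w = - (x + y)" using that by simp
    from that(3) show False
    proof
      assume "n dvd w - z \<or> n dvd w + z"
      then show False
      proof
        assume "n dvd w + z"
        moreover have "x + y - z = - (w + z)" unfolding w by simp
        ultimately have "n dvd (x + y) - z" by (simp only: dvd_minus_iff)
        then show False using periodicD[OF perS xy] z(1) by blast
      next
        assume "n dvd w - z"
        moreover have "x + y - (- z) = - (w - z)" unfolding w by simp
        ultimately have "n dvd (x + y) - (- z)" by (simp only: dvd_minus_iff)
        then have "- z \<in> sumset S" using periodicD[OF perS xy] by blast
        then show False using neg z(1) by blast
      qed
    qed
  qed
  have Zsum: "y + w \<in> sumset S" if "y \<in> ?Z" "w \<in> ?Z" for y w
  proof -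
    have m2: "- (2 * z) \<in> sumset S" using neg[of "- (2 * z)"] z(2) by simp
    have "n dvd 2 * z - (y + w) \<or> n dvd - (2 * z) - (y + w) \<or> n dvd 0 - (y + w)"
    proof -
      have "n dvd 2 * z - (y + w)" if "n dvd y - z" "n dvd w - z"
        using dvd_add[OF that] by (subst dvd_minus_iff[symmetric]) (simp add: algebra_simps)
      moreover have "n dvd - (2 * z) - (y + w)" if "n dvd y + z" "n dvd w + z"
        using dvd_add[OF that] by (subst dvd_minus_iff[symmetric]) (simp add: algebra_simps)
      moreover have "n dvd 0 - (y + w)" if "n dvd y - z" "n dvd w + z"
        using dvd_add[OF that] by (subst dvd_minus_iff[symmetric]) (simp add: algebra_simps)
      moreover have "n dvd 0 - (y + w)" if "n dvd y + z" "n dvd w - z"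
        using dvd_add[OF that] by (subst dvd_minus_iff[symmetric]) (simp add: algebra_simps)
      ultimately show ?thesis using that unfolding mem_Collect_eq by satx
    qed
    then show ?thesis using periodicD[OF perS z(2)] periodicD[OF perS m2] periodicD[OF perS zero] by blast
  qed
  have two: False if "x \<in> S" "y \<in> ?Z" "w \<in> ?Z" "x + y + w = 0" for x y w
  proof -
    have "- x = y + w" using that by simp
    then have "- x \<in> sumset S" using Zsum[OF that(2,3)] by (simp only:)
    then show False using neg dis that(1) by blast
  qed
  have three: False if "x \<in> ?Z" "y \<in> ?Z" "w \<in> ?Z" "x + y + w = 0" for x y w
  proof -
    have "- x = y + w" using that by simp
    then have mx: "- x \<in> sumset S" using Zsum[OF that(2,3)] by (simp only:)
    then have x: "x \<in> sumset S" by (rule neg)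
    have "n dvd x - z \<or> n dvd - x - z"
      using that(1) dvd_minus_iff[of n "x + z"] by auto
    then show False using periodicD[OF perS x] periodicD[OF perS mx] z(1) by blast
  qed
  show "x + y + w \<noteq> 0" if "x \<in> S \<union> ?Z" "y \<in> S \<union> ?Z" "w \<in> S \<union> ?Z" for x y w
  proof
    assume e: "x + y + w = 0"
    then have e': "y + w + x = 0" "w + x + y = 0" "w + y + x = 0" "x + w + y = 0" by auto
    show False
      using that sum_freeD[OF S, of x y w] e one[of x y w] one[of y w x] one[of w x y]
        two[of x y w] two[of y w x] two[of w x y] three[of x y w] e' by blast
  qed
qed

text \<open>
  Take a symmetric sum-free extension with the most elements per period. An element \<open>z\<close> that it
  leaves uncovered is also uncovered by \<open>S0\<close>, so that its double is a sum and \<open>z\<close> could have been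
  adjoined.
\<close>

lemma complete_extension:
  assumes n: "n > 0" and S0: "sym_sum_free n S0" and "S0 \<noteq> {}"
    and dbl: "\<And>z. z \<notin> S0 \<Longrightarrow> z \<notin> sumset S0 \<Longrightarrow> 2 * z \<in> sumset S0"
  obtains S where "complete_sum_free n S" "S0 \<subseteq> S"
proof -
  let ?P = "\<lambda>S. sym_sum_free n S \<and> S0 \<subseteq> S"
  let ?f = "\<lambda>S. card (S \<inter> {0..<n})"
  have bound: "?f S < Suc (nat n)" for S
    using card_mono[of "{0..<n}" "S \<inter> {0..<n}"] by simp
  obtain S where S: "sym_sum_free n S" "S0 \<subseteq> S" and max: "\<And>S'. ?P S' \<Longrightarrow> ?f S' \<le> ?f S"
    using ex_has_greatest_nat[of ?P S0 ?f "Suc (nat n)"] S0 bound by blast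
  have "z \<in> S \<union> sumset S" for z
  proof (rule ccontr)
    assume z: "z \<notin> S \<union> sumset S"
    let ?S' = "S \<union> {x. n dvd x - z \<or> n dvd x + z}"
    have sub: "sumset S0 \<subseteq> sumset S" using sumset_mono[OF S(2)] .
    then have "2 * z \<in> sumset S" using dbl[of z] z S(2) by auto
    then have "?P ?S'" using sum_free_adjoin[OF S(1)] \<open>S0 \<noteq> {}\<close> S(2) z by auto
    then have "?f ?S' \<le> ?f S" by (rule max)
    moreover have "S \<inter> {0..<n} \<subset> ?S' \<inter> {0..<n}"
    proof -
      have m: "n dvd z mod n - z" by (simp add: mod_eq_dvd_iff[symmetric])
      then have "z mod n \<in> ?S' \<inter> {0..<n}" using n by simp
      moreover have "z mod n \<notin> S"
        using periodicD[of n S "z mod n" z] m S(1) z unfolding sym_sum_free_def by blast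
      ultimately show ?thesis by blast
    qed
    then have "?f S < ?f ?S'" by (intro psubset_card_mono) auto
    ultimately show False by simp
  qed
  then show ?thesis using that[of S] S unfolding complete_sum_free_def by auto
qed

section \<open>Counting in periodic sets\<close>

lemma card_period_window:
  assumes "q > 0" and "periodic q P"
  shows "card (P \<inter> {u..<u + q}) = card (P \<inter> {0..<q})"
proof (rule bij_betw_same_card[of "\<lambda>x. x mod q"], unfold bij_betw_def, intro conjI)
  show "inj_on (\<lambda>x. x mod q) (P \<inter> {u..<u + q})"
  proof (rule inj_onI)
    fix x y assume "x \<in> P \<inter> {u..<u + q}" "y \<in> P \<inter> {u..<u + q}" "x mod q = y mod q"
    then have "q dvd x - y" "\<bar>x - y\<bar> < q" by (auto simp: mod_eq_dvd_iff)
    then show "x = y" using dvd_imp_le_int[of "x - y" q] by auto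
  qed
  have md: "q dvd x - x mod q" for x by simp
  show "(\<lambda>x. x mod q) ` (P \<inter> {u..<u + q}) = P \<inter> {0..<q}"
  proof (intro equalityI subsetI)
    fix y assume "y \<in> (\<lambda>x. x mod q) ` (P \<inter> {u..<u + q})"
    then show "y \<in> P \<inter> {0..<q}" using periodicD[OF assms(2) _ md] assms(1) by auto
  next
    fix y assume y: "y \<in> P \<inter> {0..<q}"
    let ?x = "u + (y - u) mod q"
    have e: "?x mod q = y mod q" by (simp add: mod_simps)
    then have "q dvd y - ?x" by (simp add: mod_eq_dvd_iff[symmetric])
    then have "?x \<in> P \<inter> {u..<u + q}" using periodicD[OF assms(2), of y ?x] y assms(1) by auto
    moreover have "y = ?x mod q" using e y by simp
    ultimately show "y \<in> (\<lambda>x. x mod q) ` (P \<inter> {u..<u + q})" by blast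
  qed
qed

text \<open>
  The interval splits into full periods, which are counted exactly, and a rest shorter than \<open>q\<close>.
\<close>

lemma card_interval_density:
  assumes q: "q > 0" and P: "periodic q P" and "m \<ge> 0"
  shows "\<bar>real (card (P \<inter> {u..<u + m})) - density q P * real_of_int m\<bar> \<le> real_of_int q"
proof -
  let ?p = "card (P \<inter> {0..<q})"
  have blocks: "card (P \<inter> {u..<u + q * int k}) = k * ?p" for k
  proof (induction k)
    case (Suc k)
    have "P \<inter> {u..<u + q * int (Suc k)}
        = (P \<inter> {u..<u + q * int k}) \<union> (P \<inter> {u + q * int k..<(u + q * int k) + q})"
    proof -
      have "{u..<u + q * int (Suc k)} = {u..<u + q * int k} \<union> {u + q * int k..<(u + q * int k) + q}"
        using q by (subst ivl_disj_un) (auto simp: algebra_simps)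
      then show ?thesis by blast
    qed
    then have "card (P \<inter> {u..<u + q * int (Suc k)})
        = card (P \<inter> {u..<u + q * int k}) + card (P \<inter> {u + q * int k..<(u + q * int k) + q})"
      by (simp only:) (rule card_Un_disjoint, auto)
    then show ?case using Suc card_period_window[OF q P] by simp
  qed simp
  define k where "k = nat (m div q)"
  define r where "r = m mod q"
  have k: "int k = m div q" using q \<open>m \<ge> 0\<close> unfolding k_def by (simp add: pos_imp_zdiv_nonneg_iff)
  have r: "0 \<le> r" "r < q" and m: "m = q * int k + r" using q unfolding r_def k by auto
  have split: "P \<inter> {u..<u + m} = (P \<inter> {u..<u + q * int k}) \<union> (P \<inter> {u + q * int k..<u + m})"
  proof -
    have "{u..<u + m} = {u..<u + q * int k} \<union> {u + q * int k..<u + m}"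
      using q r m by (subst ivl_disj_un) auto
    then show ?thesis by blast
  qed
  have "card (P \<inter> {u..<u + m})
      = card (P \<inter> {u..<u + q * int k}) + card (P \<inter> {u + q * int k..<u + m})"
    unfolding split by (rule card_Un_disjoint) auto
  moreover have "card (P \<inter> {u + q * int k..<u + m}) \<le> card {u + q * int k..<u + m}"
    by (rule card_mono) auto
  ultimately have c: "k * ?p \<le> card (P \<inter> {u..<u + m})"
    "real (card (P \<inter> {u..<u + m})) \<le> k * ?p + real_of_int r"
    using blocks[of k] m r by auto
  have "?p \<le> card {0..<q}" by (rule card_mono) auto
  then have p: "real ?p \<le> real_of_int q" using q by auto
  have e: "density q P * real_of_int m = k * ?p + density q P * real_of_int r"
    unfolding m density_def using q by (simp add: field_simps)
  have "0 \<le> density q P" "density q P \<le> 1" unfolding density_def using p q by auto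
  then have "0 \<le> density q P * real_of_int r" "density q P * real_of_int r \<le> real_of_int r"
    using r by (auto simp: mult_left_le_one_le)
  moreover have "real (k * ?p) \<le> real (card (P \<inter> {u..<u + m}))" using c(1) of_nat_le_iff by blast
  ultimately show ?thesis using c(2) e r by (simp add: abs_le_iff)
qed

lemma periodic_meets_window:
  assumes "q > 0" and "periodic q P" and "P \<noteq> {}"
  obtains x where "x \<in> P" "u \<le> x" "x < u + q"
proof -
  obtain y where y: "y \<in> P" using assms(3) by blast
  let ?x = "u + (y - u) mod q"
  have "?x mod q = y mod q" by (simp add: mod_simps)
  then have "q dvd y - ?x" by (simp add: mod_eq_dvd_iff[symmetric])
  then have "?x \<in> P" using periodicD[OF assms(2) y] by blast
  moreover have "u \<le> ?x" "?x < u + q" using assms(1) by auto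
  ultimately show ?thesis by (rule that)
qed

section \<open>Refining a complete sum-free set\<close>

text \<open>
  The condition \<open>a - c \<in> C\<close> makes \<open>a\<close> itself an element of the seed. Then \<open>middle - a\<close> reaches up to
  \<open>a - 1\<close>, so no gap remains just below \<open>a\<close>; \<open>complete_extension\<close> would not deal with such a gap,
  as the doubles of its elements may lie in \<open>middle\<close>. The lower bound on \<open>a\<close> makes \<open>middle\<close>
  at least one period long, and the upper bound makes \<open>[a, n - 2a]\<close> longer than two periods.
\<close>

locale refinement =
  fixes q n a c :: int and C :: "int set"
  assumes q: "q > 0"
    and C: "complete_sum_free q C"
    and c: "q dvd n - 3 * c"
    and a: "a - c \<in> C"
    and lower: "n + q + 1 \<le> 4 * a"
    and upper: "3 * a + 2 * q \<le> n"
begin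

definition outer :: "int set"
  where "outer = {x \<in> {a..n - 2 * a}. x - c \<in> C}"

definition middle :: "int set"
  where "middle = {n - 2 * a + 1..2 * a - 1}"

definition base :: "int set"
  where "base = outer \<union> middle \<union> (\<lambda>x. n - x) ` outer"

definition seed :: "int set"
  where "seed = {x. x mod n \<in> base}"

lemma a_pos: "a > 0" and n_pos: "n > 0"
  using q lower upper by auto

lemma C_sf: "sym_sum_free q C" and C_per: "periodic q C"
  and C_sym: "x \<in> C \<Longrightarrow> - x \<in> C" and C_complete: "x \<in> C \<or> x \<in> sumset C"
  using C unfolding complete_sum_free_def sym_sum_free_def by auto

lemma base_bounds: "x \<in> base \<Longrightarrow> a \<le> x \<and> x \<le> n - a"
  using lower upper q unfolding base_def outer_def middle_def by auto

lemma base_reflect: "x \<in> base \<Longrightarrow> n - x \<in> base"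
  unfolding base_def middle_def by (auto simp: image_iff)

text \<open>
  Every element is at least \<open>a\<close>, so each member of a triple with sum \<open>n\<close> is at most \<open>n - 2a\<close> and hence
  in \<open>outer\<close>. Relative to \<open>c\<close> the three elements would form a zero-sum triple in \<open>C\<close>, because
  \<open>n - 3c\<close> is a multiple of \<open>q\<close>.
\<close>

lemma base_no_triple:
  assumes "x \<in> base" "y \<in> base" "z \<in> base"
  shows "x + y + z \<noteq> n"
proof
  assume s: "x + y + z = n"
  have small: "u \<in> outer" if "u \<in> base" "u \<le> n - 2 * a" for u
    using that lower upper q unfolding base_def outer_def middle_def by auto
  have "x \<in> outer" "y \<in> outer" "z \<in> outer"
    using small[OF assms(1)] small[OF assms(2)] small[OF assms(3)]
      base_bounds[OF assms(1)] base_bounds[OF assms(2)] base_bounds[OF assms(3)] s by auto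
  then have in_C: "x - c \<in> C" "y - c \<in> C" "z - c \<in> C" unfolding outer_def by auto
  let ?w = "- (x - c) - (y - c)"
  have "?w \<in> C"
  proof (rule periodicD[OF C_per in_C(3)])
    have "z - c - ?w = n - 3 * c" using s by simp
    then show "q dvd z - c - ?w" using c by simp
  qed
  then show False using sum_freeD[OF C_sf in_C(1,2), of ?w] by simp
qed

lemma seed_periodic: "periodic n seed"
  unfolding periodic_def seed_def by (auto simp: mod_eq_dvd_iff[symmetric])

lemma base_subset_seed: "base \<subseteq> seed"
  using base_bounds a_pos n_pos unfolding seed_def by (force simp: mod_pos_pos_trivial)

lemma seed_uminus: "x \<in> seed \<Longrightarrow> - x \<in> seed"
proof -
  assume "x \<in> seed"
  then have "n - x mod n \<in> seed" using base_reflect base_subset_seed unfolding seed_def by blast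
  then show "- x \<in> seed"
  proof (rule periodicD[OF seed_periodic])
    have "n - x mod n - - x = n + (x - x mod n)" by simp
    also have "n dvd \<dots>" by (intro dvd_add) auto
    finally show "n dvd n - x mod n - - x" .
  qed
qed

text \<open>
  Three representatives between \<open>0\<close> and \<open>n\<close> whose sum vanishes modulo \<open>n\<close> add up to \<open>n\<close> or \<open>2n\<close>, and
  reflection exchanges the two cases.
\<close>

lemma seed_sym_sum_free: "sym_sum_free n seed"
proof (rule sym_sum_freeI[OF seed_periodic seed_uminus])
  fix x y w assume "x \<in> seed" "y \<in> seed" "w \<in> seed"
  then have b: "x mod n \<in> base" "y mod n \<in> base" "w mod n \<in> base" unfolding seed_def by auto
  show "x + y + w \<noteq> 0"
  proof
    assume "x + y + w = 0"
    moreover have "(x mod n + y mod n + w mod n) mod n = (x + y + w) mod n" by (metis mod_add_eq mod_add_left_eq)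
    ultimately have "(x mod n + y mod n + w mod n) mod n = 0" by simp
    then obtain k where k: "x mod n + y mod n + w mod n = n * k" by (auto simp: dvd_def)
    have "0 < u + v + t \<and> u + v + t < n * 3" if "u \<in> base" "v \<in> base" "t \<in> base" for u v t
      using base_bounds[OF that(1)] base_bounds[OF that(2)] base_bounds[OF that(3)] a_pos by linarith
    then have "0 < n * k" "n * k < n * 3" using b k by metis+
    then have "0 < k" "k < 3" using n_pos by (simp_all add: zero_less_mult_iff mult_less_cancel_left_pos)
    then consider "k = 1" | "k = 2" by linarith
    then show False
    proof cases
      case 1
      then show False using base_no_triple[OF b] k by simp
    next
      case 2
      then show False
        using base_no_triple[OF base_reflect[OF b(1)] base_reflect[OF b(2)] base_reflect[OF b(3)]] k
        by simp
    qed
  qed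
qed

lemma covered_small:
  assumes "0 \<le> z" "z < q"
  shows "z \<in> sumset seed"
proof (rule sumsetI)
  have m: "n - 2 * a + 1 \<in> middle" "n - 2 * a + 1 + z \<in> middle"
    using assms lower unfolding middle_def by auto
  then show "n - 2 * a + 1 + z \<in> seed" "- (n - 2 * a + 1) \<in> seed"
    using base_subset_seed seed_uminus unfolding base_def by blast+
qed simp

text \<open>
  The translates of \<open>middle\<close> by the negatives of \<open>outer\<close> leave no gaps, since consecutive elements
  of \<open>outer\<close> differ by at most \<open>q\<close>, the least possible length of \<open>middle\<close>.
\<close>

lemma covered_medium:
  assumes "q \<le> z" "z < a"
  shows "z \<in> sumset seed"
proof -
  have "\<exists>x \<in> outer. x + z \<in> middle"
  proof (cases "z < n - 3 * a + 1")
    case True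
    have "periodic q {x. x - c \<in> C}"
      unfolding periodic_def
    proof (intro allI impI, unfold mem_Collect_eq)
      fix x y assume "q dvd x - y" "x - c \<in> C"
      then show "y - c \<in> C" using periodicD[OF C_per, of "x - c" "y - c"] by simp
    qed
    moreover have "{x. x - c \<in> C} \<noteq> {}" using a by blast
    ultimately obtain x where x: "x - c \<in> C" "n - 2 * a + 1 - z \<le> x" "x < n - 2 * a + 1 - z + q"
      using periodic_meets_window[OF q] by (metis mem_Collect_eq)
    then have "x \<in> outer" "x + z \<in> middle"
      using True assms lower unfolding outer_def middle_def by auto
    then show ?thesis by blast
  next
    case False
    then have "a \<in> outer" "a + z \<in> middle"
      using a assms upper q unfolding outer_def middle_def by auto
    then show ?thesis by blast
  qed
  then obtain x where "x \<in> outer" "x + z \<in> middle" by blast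
  then have "- x \<in> seed" "x + z \<in> seed"
    using base_subset_seed seed_uminus unfolding base_def by auto
  then show ?thesis by (auto intro: sumsetI)
qed

text \<open>
  Outside \<open>c + C\<close> the completeness of \<open>C\<close> gives \<open>z - c = u + v\<close>. Elements \<open>x\<close> and \<open>y\<close> of \<open>outer\<close> with
  residues \<open>c - u\<close> and \<open>c - v\<close> have \<open>x + y \<equiv> 3c - z \<equiv> n - z\<close> modulo \<open>q\<close>, so the smallest such \<open>x\<close>
  leaves a \<open>y\<close> with \<open>x + y = n - z\<close> exactly, and \<open>z\<close> is the sum of \<open>n - x\<close> and \<open>- y\<close>.
\<close>

lemma covered_outer:
  assumes "a \<le> z" "z \<le> n - 2 * a - q + 1"
  shows "z \<in> seed \<or> z \<in> sumset seed"
proof (cases "z - c \<in> C")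
  case True
  then have "z \<in> outer" using assms q unfolding outer_def by auto
  then show ?thesis using base_subset_seed unfolding base_def by auto
next
  case False
  then obtain u v where uv: "u \<in> C" "v \<in> C" "z - c = u + v"
    using C_complete[of "z - c"] unfolding sumset_def by blast
  define x where "x = a + (c - u - a) mod q"
  define y where "y = n - z - x"
  have x_range: "a \<le> x" "x < a + q" using q unfolding x_def by auto
  have "x mod q = (c - u) mod q" unfolding x_def by (simp add: mod_simps)
  then have "q dvd x - (c - u)" by (simp add: mod_eq_dvd_iff)
  then have dx: "q dvd - u - (x - c)" using dvd_minus_iff[of q "x - (c - u)"] by (simp add: algebra_simps)
  have "- v - (y - c) = - (n - 3 * c) - (- u - (x - c))" using uv(3) unfolding y_def by simp
  then have dy: "q dvd - v - (y - c)" using c dx by (metis dvd_diff dvd_minus_iff)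
  have "x - c \<in> C" "y - c \<in> C"
    using periodicD[OF C_per C_sym[OF uv(1)] dx] periodicD[OF C_per C_sym[OF uv(2)] dy] by auto
  then have "x \<in> outer" "y \<in> outer"
    using assms x_range upper q unfolding outer_def y_def by auto
  then have "n - x \<in> seed" "- y \<in> seed"
    using base_subset_seed seed_uminus unfolding base_def by auto
  then have "z \<in> sumset seed" by (rule sumsetI) (simp add: y_def)
  then show ?thesis ..
qed

lemma uncovered_range:
  assumes "0 \<le> z" "z < n" "z \<notin> seed" "z \<notin> sumset seed"
  shows "z \<in> {n - 2 * a - q + 2..n - 2 * a} \<or> n - z \<in> {n - 2 * a - q + 2..n - 2 * a}"
proof -
  have left: "u \<in> {n - 2 * a - q + 2..n - 2 * a}"
    if u: "0 \<le> u" "u \<notin> seed" "u \<notin> sumset seed" "u < 2 * a" for u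
  proof -
    have "u \<notin> middle" using u base_subset_seed unfolding base_def by auto
    then have "u \<le> n - 2 * a" using u unfolding middle_def by auto
    moreover have "q \<le> u" using covered_small u by force
    moreover have "a \<le> u" using covered_medium[of u] u \<open>q \<le> u\<close> by force
    ultimately show ?thesis using covered_outer[of u] u by force
  qed
  show ?thesis
  proof (cases "z < 2 * a")
    case True
    then show ?thesis using left assms by blast
  next
    case False
    have d: "n dvd n - z - - z" by simp
    have "n - z \<notin> seed" using periodicD[OF seed_periodic _ d] seed_uminus[of "- z"] assms by auto
    moreover have "n - z \<notin> sumset seed"
      using periodicD[OF sumset_periodic[OF seed_periodic] _ d] sumset_uminus[of seed "- z"]
        seed_uminus assms by auto
    moreover have "n - z < 2 * a" using False lower q by auto
    ultimately show ?thesis using left[of "n - z"] assms by auto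
  qed
qed

text \<open>
  Modulo \<open>n\<close> and up to sign, an uncovered element is some \<open>u \<le> n - 2a\<close> with \<open>n - 2a - u < q\<close>. Then
  \<open>n - 2u\<close> is at least \<open>4a - n\<close>, which exceeds \<open>q\<close>, and below \<open>a\<close>, hence a sum by \<open>covered_medium\<close>.
\<close>

lemma uncovered_double:
  assumes "z \<notin> seed" "z \<notin> sumset seed"
  shows "2 * z \<in> sumset seed"
proof -
  note per = sumset_periodic[OF seed_periodic]
  have core: "2 * u \<in> sumset seed" if "u \<in> {n - 2 * a - q + 2..n - 2 * a}" for u
  proof -
    have "n - 2 * u \<in> sumset seed" using that lower upper by (intro covered_medium) auto
    then have "- (n - 2 * u) \<in> sumset seed" using sumset_uminus seed_uminus by blast
    then show ?thesis by (rule periodicD[OF per]) simp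
  qed
  have d: "n dvd z mod n - z" by (simp add: mod_eq_dvd_iff[symmetric])
  have "z mod n \<notin> seed" "z mod n \<notin> sumset seed"
    using assms periodicD[OF seed_periodic _ d] periodicD[OF per _ d] by auto
  then have "z mod n \<in> {n - 2 * a - q + 2..n - 2 * a} \<or> n - z mod n \<in> {n - 2 * a - q + 2..n - 2 * a}"
    using n_pos by (intro uncovered_range) auto
  then show ?thesis
  proof
    assume "z mod n \<in> {n - 2 * a - q + 2..n - 2 * a}"
    moreover have "n dvd 2 * (z mod n) - 2 * z"
      using dvd_mult[OF d, of 2] by (simp add: algebra_simps)
    ultimately show ?thesis using core periodicD[OF per] by blast
  next
    assume "n - z mod n \<in> {n - 2 * a - q + 2..n - 2 * a}"
    then have "- (2 * (n - z mod n)) \<in> sumset seed"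
      using core sumset_uminus seed_uminus by blast
    then show ?thesis
    proof (rule periodicD[OF per])
      have "- (2 * (n - z mod n)) - 2 * z = 2 * (z mod n - z) - 2 * n" by simp
      then show "n dvd - (2 * (n - z mod n)) - 2 * z" using d by (metis dvd_diff dvd_mult dvd_triv_right)
    qed
  qed
qed

lemma card_base: "int (card base) = 2 * int (card outer) + (4 * a - n - 1)"
proof -
  have fin: "finite outer" "finite middle"
    unfolding middle_def by (rule finite_subset[of _ "{a..n - 2 * a}"]) (auto simp: outer_def)
  have "card ((\<lambda>x. n - x) ` outer) = card outer" by (rule card_image) (auto intro: inj_onI)
  moreover have "card base = card outer + card middle + card ((\<lambda>x. n - x) ` outer)"
  proof -
    have d1: "outer \<inter> middle = {}" unfolding outer_def middle_def by auto
    have d2: "(outer \<union> middle) \<inter> (\<lambda>x. n - x) ` outer = {}"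
      using lower q unfolding outer_def middle_def by auto
    show ?thesis unfolding base_def using fin d1 d2 by (simp add: card_Un_disjoint)
  qed
  moreover have "int (card middle) = 4 * a - n - 1" using lower q unfolding middle_def by simp
  ultimately show ?thesis by simp
qed

lemma card_outer:
  "\<bar>real (card outer) - density q C * real_of_int (n - 3 * a + 1)\<bar> \<le> real_of_int q"
proof -
  have "outer = (\<lambda>x. x + c) ` (C \<inter> {a - c..<(a - c) + (n - 3 * a + 1)})"
  proof (intro equalityI subsetI)
    fix x assume "x \<in> outer"
    then have "x - c \<in> C \<inter> {a - c..<(a - c) + (n - 3 * a + 1)}" unfolding outer_def by auto
    then show "x \<in> (\<lambda>x. x + c) ` (C \<inter> {a - c..<(a - c) + (n - 3 * a + 1)})" by force
  qed (auto simp: outer_def)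
  then have "card outer = card (C \<inter> {a - c..<(a - c) + (n - 3 * a + 1)})"
    by (simp add: card_image)
  then show ?thesis using card_interval_density[OF q C_per, of "n - 3 * a + 1" "a - c"] upper q
    by simp
qed

lemma density_le_1: "0 \<le> density q C \<and> density q C \<le> 1"
proof -
  have "card (C \<inter> {0..<q}) \<le> card {0..<q}" by (rule card_mono) auto
  then show ?thesis using q unfolding density_def by auto
qed

text \<open>
  The completion of the seed adds only uncovered elements, fewer than \<open>2q\<close> per period.
\<close>

lemma refined_set:
  obtains S where "complete_sum_free n S"
    "\<bar>real (card (S \<inter> {0..<n})) - (4 * a - n + 2 * density q C * (n - 3 * a))\<bar> \<le> 7 * q"
proof -
  have "base \<noteq> {}" using lower q unfolding base_def middle_def by auto
  then have "seed \<noteq> {}" using base_subset_seed by blast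
  then obtain S where S: "complete_sum_free n S" "seed \<subseteq> S"
    using complete_extension[OF n_pos seed_sym_sum_free] uncovered_double by blast
  let ?W = "{n - 2 * a - q + 2..n - 2 * a}"
  have up: "S \<inter> {0..<n} \<subseteq> base \<union> ?W \<union> (\<lambda>x. n - x) ` ?W"
  proof
    fix z assume z: "z \<in> S \<inter> {0..<n}"
    then have "z \<notin> sumset seed"
      using S sumset_mono[OF S(2)] unfolding complete_sum_free_def sym_sum_free_def by blast
    moreover have "z \<in> base" if "z \<in> seed" using that z unfolding seed_def by simp
    moreover have "z \<in> (\<lambda>x. n - x) ` ?W" if "n - z \<in> ?W"
      by (rule image_eqI[OF _ that]) simp
    ultimately show "z \<in> base \<union> ?W \<union> (\<lambda>x. n - x) ` ?W"
      using uncovered_range[of z] z by (meson IntD2 UnCI atLeastLessThan_iff)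
  qed
  have down: "base \<subseteq> S \<inter> {0..<n}"
    using base_subset_seed S(2) base_bounds a_pos by fastforce
  have finb: "finite base" using down by (rule finite_subset) simp
  have "card (S \<inter> {0..<n}) \<le> card (base \<union> ?W \<union> (\<lambda>x. n - x) ` ?W)"
    using finb by (intro card_mono[OF _ up]) auto
  also have "\<dots> \<le> card base + card ?W + card ((\<lambda>x. n - x) ` ?W)"
    by (meson add_le_mono1 card_Un_le order_trans)
  also have "\<dots> \<le> card base + card ?W + card ?W"
    by (simp add: card_image_le)
  finally have 1: "real (card (S \<inter> {0..<n})) \<le> card base + 2 * q" using q by simp
  have 2: "card base \<le> card (S \<inter> {0..<n})" by (rule card_mono[OF _ down]) simp
  have 3: "real (card base) = 2 * real (card outer) + real_of_int (4 * a - n - 1)"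
    using card_base by (metis of_int_add of_int_mult of_int_numeral of_int_of_nat_eq)
  have "\<bar>real (card (S \<inter> {0..<n})) - (4 * a - n + 2 * density q C * (n - 3 * a))\<bar> \<le> 7 * q"
    using 1 2 3 card_outer density_le_1 q by (simp add: algebra_simps abs_le_iff)
  with S(1) show ?thesis by (rule that)
qed

end

section \<open>The attainable densities\<close>

text \<open>
  Writing \<open>\<alpha>\<close> as the point with parameter \<open>l\<close> between \<open>\<kappa>/2\<close> and \<open>1/3\<close>, the size formula of
  \<open>refined_set\<close> is met by \<open>a/n = 1/4 + l/12\<close>. Moving \<open>a\<close> by \<open>O(q)\<close>, to satisfy the constraints of the
  construction, changes the size by \<open>O(q)\<close>.
\<close>

lemma densities_from_set:
  assumes q: "q > 0" "\<not> 3 dvd q" and C: "complete_sum_free q C"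
    and \<alpha>: "density q C / 2 \<le> \<alpha>" "\<alpha> \<le> 1 / 3"
    and n: "38 * q \<le> n"
  obtains S where "complete_sum_free n S" "\<bar>density n S - \<alpha>\<bar> \<le> 23 * q / n"
proof -
  define \<kappa> where "\<kappa> = density q C"
  obtain l where l: "0 \<le> l" "l \<le> 1" "\<alpha> = l / 3 + (1 - l) * \<kappa> / 2"
  proof (cases "\<kappa> / 2 = 1 / 3")
    case True
    then show ?thesis using that[of 0] \<alpha> unfolding \<kappa>_def by simp
  next
    case False
    then have pos: "1 / 3 - \<kappa> / 2 > 0" using \<alpha> unfolding \<kappa>_def by simp
    show ?thesis
    proof (rule that[of "(\<alpha> - \<kappa> / 2) / (1 / 3 - \<kappa> / 2)"])
      let ?l = "(\<alpha> - \<kappa> / 2) / (1 / 3 - \<kappa> / 2)"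
      show "0 \<le> ?l" "?l \<le> 1" using pos \<alpha> unfolding \<kappa>_def by (auto simp: divide_le_eq)
      have "?l * (1 / 3 - \<kappa> / 2) = \<alpha> - \<kappa> / 2" using pos by simp
      moreover have "x / 3 + (1 - x) * \<kappa> / 2 = x * (1 / 3 - \<kappa> / 2) + \<kappa> / 2" for x :: real
        by (simp add: field_simps)
      ultimately show "\<alpha> = ?l / 3 + (1 - ?l) * \<kappa> / 2" by (metis diff_add_cancel)
    qed
  qed
  define \<theta> where "\<theta> = 1 / 4 + l / 12"
  have \<theta>: "1 / 4 \<le> \<theta>" "\<theta> \<le> 1 / 3" using l unfolding \<theta>_def by auto
  \<comment> \<open>As 3 is invertible modulo \<open>q\<close>, its inverse can be written down for either residue of \<open>q\<close>.\<close>
  obtain c where c: "q dvd n - 3 * c"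
  proof (cases "q mod 3 = 1")
    case True
    then have "q = 3 * (q div 3) + 1" by presburger
    then have "n - 3 * (- (q div 3) * n) = q * n" by (simp add: algebra_simps) algebra
    then show ?thesis using that by (metis dvd_triv_left)
  next
    case False
    then have "q = 3 * (q div 3) + 2" using q(2) by presburger
    then have "n - 3 * ((q div 3 + 1) * n) = q * (- n)" by algebra
    then show ?thesis using that by (metis dvd_triv_left)
  qed
  \<comment> \<open>The constants make \<open>t\<close> equal to \<open>n/4 + 3q/2\<close> for \<open>\<theta> = 1/4\<close> and \<open>n/3 - 5q/3\<close> for \<open>\<theta> = 1/3\<close>, so
    that all of \<open>[\<lfloor>t\<rfloor>, \<lfloor>t\<rfloor> + q)\<close> is admissible for \<open>a\<close>; this window meets \<open>c + C\<close>.\<close>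
  define t where "t = \<theta> * (n - 38 * q) + 11 * q"
  have perC: "periodic q C" using C unfolding complete_sum_free_def sym_sum_free_def by blast
  obtain x where x: "x \<in> C" "\<lfloor>t\<rfloor> - c \<le> x" "x < \<lfloor>t\<rfloor> - c + q"
    using periodic_meets_window[OF q(1) perC complete_nonempty[OF C]] by blast
  define a where "a = x + c"
  have a_near: "t - 1 \<le> a" "a \<le> t + q - 1"
    using x floor_correct[of t] unfolding a_def by linarith+
  have nq: "0 \<le> real_of_int n - 38 * q" using n by (simp add: of_int_le_iff[symmetric] del: of_int_le_iff)
  have q1: "1 \<le> real_of_int q" using q by simp
  have t1: "(1 / 4) * (real_of_int n - 38 * q) \<le> t - 11 * q"
    unfolding t_def using mult_right_mono[OF \<theta>(1) nq] by simp
  have t2: "t - 11 * q \<le> (1 / 3) * (real_of_int n - 38 * q)"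
    unfolding t_def using mult_right_mono[OF \<theta>(2) nq] by simp
  have "real_of_int (n + q + 1) \<le> real_of_int (4 * a)" using a_near t1 q1 by simp
  then have lower: "n + q + 1 \<le> 4 * a" by (simp only: of_int_le_iff)
  have "real_of_int (3 * a + 2 * q) \<le> real_of_int n" using a_near t2 q1 by simp
  then have upper: "3 * a + 2 * q \<le> n" by (simp only: of_int_le_iff)
  interpret refinement q n a c C
    using q C c x lower upper by unfold_locales (auto simp: a_def)
  obtain S where S: "complete_sum_free n S"
    and card: "\<bar>real (card (S \<inter> {0..<n})) - (4 * a - n + 2 * \<kappa> * (n - 3 * a))\<bar> \<le> 7 * q"
    using refined_set unfolding \<kappa>_def by blast
  have npos: "0 < real_of_int n" using n_pos by simp
  have \<kappa>: "0 \<le> \<kappa>" "\<kappa> \<le> 1" using density_le_1 unfolding \<kappa>_def by auto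
  define e where "e = a - \<theta> * n"
  have "e \<le> 4 * q" "- (4 * q) \<le> e"
  proof -
    have "(1 / 4) * real_of_int q \<le> \<theta> * q" "\<theta> * q \<le> (1 / 3) * real_of_int q"
      using \<theta> q1 by (intro mult_right_mono; simp)+
    moreover have "t = \<theta> * n - 38 * (\<theta> * q) + 11 * q" unfolding t_def by (simp add: algebra_simps)
    ultimately show "e \<le> 4 * q" "- (4 * q) \<le> e"
      using a_near q1 unfolding e_def by linarith+
  qed
  then have "\<bar>(4 - 6 * \<kappa>) * e\<bar> \<le> 4 * real_of_int (4 * q)"
    unfolding abs_mult using \<kappa> by (intro mult_mono) (auto simp: abs_le_iff)
  moreover have "4 * a - n + 2 * \<kappa> * (n - 3 * a) = \<alpha> * n + (4 - 6 * \<kappa>) * e"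
    unfolding e_def \<theta>_def l(3) by (simp add: field_simps)
  ultimately have "\<bar>real (card (S \<inter> {0..<n})) - \<alpha> * n\<bar> \<le> 23 * q" using card by linarith
  moreover have "density n S - \<alpha> = (real (card (S \<inter> {0..<n})) - \<alpha> * n) / n"
    unfolding density_def using npos by (simp add: field_simps)
  ultimately have "\<bar>density n S - \<alpha>\<bar> \<le> 23 * q / n"
    using npos by (simp add: divide_right_mono)
  with S show ?thesis by (intro that) auto
qed

lemma odd_complete_sum_free: "complete_sum_free 2 {x. odd x}"
proof -
  have "sumset {x. odd x} = {x. even x}"
  proof (intro equalityI subsetI)
    fix z :: int assume "z \<in> {x. even x}"
    then show "z \<in> sumset {x. odd x}" by (intro sumsetI[of "z - 1" _ 1]) auto
  qed (auto simp: sumset_def)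
  moreover have "periodic 2 {x. odd x}" unfolding periodic_def by simp
  ultimately show ?thesis unfolding complete_sum_free_def sym_sum_free_def by auto
qed

text \<open>
  Each step asks for the smallest density \<open>\<kappa>/2\<close> that a set of density \<open>\<kappa>\<close> provides, and the error
  term costs at most another \<open>\<kappa>/4\<close>. The new period is chosen congruent to 1 modulo 3, so that the
  construction can be applied again.
\<close>

lemma sparse_complete_sum_free:
  "\<exists>q C. q > 0 \<and> \<not> 3 dvd q \<and> complete_sum_free q C \<and> density q C \<le> (3 / 4) ^ k / 2"
proof (induction k)
  case 0
  have "{x. odd x} \<inter> {0..<2} = {1 :: int}" by (auto, presburger)
  then have "density 2 {x. odd x} \<le> (3 / 4) ^ 0 / 2" unfolding density_def by simp
  then show ?case using odd_complete_sum_free by (intro exI[of _ 2] exI[of _ "{x. odd x}"]) auto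
next
  case (Suc k)
  then obtain q C where q: "q > 0" "\<not> 3 dvd q" and C: "complete_sum_free q C"
    and d: "density q C \<le> (3 / 4) ^ k / 2" by blast
  have "(3 / 4 :: real) ^ k \<le> 1" by (simp add: power_le_one)
  then have third: "density q C / 2 \<le> 1 / 3" using d by simp
  have perC: "periodic q C" using C unfolding complete_sum_free_def sym_sum_free_def by blast
  obtain x where "x \<in> C" "0 \<le> x" "x < 0 + q"
    using periodic_meets_window[OF q(1) perC complete_nonempty[OF C]] .
  then have "C \<inter> {0..<q} \<noteq> {}" by auto
  then have dpos: "density q C > 0" unfolding density_def using q by (simp add: card_gt_0_iff)
  define n where "n = 3 * max (38 * q) \<lceil>92 * q / density q C\<rceil> + 1"
  have "0 < 38 * q" using q by simp
  then have n: "38 * q \<le> n" "0 < n" "\<lceil>92 * q / density q C\<rceil> \<le> n" "\<not> 3 dvd n"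
    unfolding n_def by (linarith | presburger)+
  obtain S where S: "complete_sum_free n S" "\<bar>density n S - density q C / 2\<bar> \<le> 23 * q / n"
    using densities_from_set[OF q C order_refl third n(1)] by auto
  have "92 * q / density q C \<le> n" using n(3) by (simp add: ceiling_le_iff)
  then have "23 * q / n \<le> density q C / 4" using dpos n(2) by (simp add: field_simps)
  then have "density n S \<le> (3 / 4) * density q C" using S(2) by linarith
  also have "\<dots> \<le> (3 / 4) ^ Suc k / 2" using d by simp
  finally show ?case using n S(1) by blast
qed

section \<open>Cyclic groups\<close>

lemma complete_sum_free_in_cyclic_group:
  assumes n: "n > 0" and S: "complete_sum_free (int n) S"
  defines "T \<equiv> S \<inter> {0..<int n}"
  shows "T \<subseteq> carrier (integer_mod_group n)"
    "symmetric_in (integer_mod_group n) T"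
    "complete_in (integer_mod_group n) T"
    "sum_free_in (integer_mod_group n) T"
proof -
  have per: "periodic (int n) S" and sym: "\<And>x. x \<in> S \<Longrightarrow> - x \<in> S"
    and sf: "S \<inter> sumset S = {}" and comp: "S \<union> sumset S = UNIV"
    using S unfolding complete_sum_free_def sym_sum_free_def by auto
  have mod_S: "x mod int n \<in> P \<longleftrightarrow> x \<in> P" if "periodic (int n) P" for x P
    using periodicD[OF that, of x "x mod int n"] periodicD[OF that, of "x mod int n" x]
    by (auto simp: mod_eq_dvd_iff[symmetric])
  have carrier: "carrier (integer_mod_group n) = {0..<int n}"
    using n by (simp add: carrier_integer_mod_group)
  show sub: "T \<subseteq> carrier (integer_mod_group n)" unfolding carrier T_def by blast
  have in_T: "x mod int n \<in> T \<longleftrightarrow> x \<in> S" for x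
    using mod_S[OF per] n unfolding T_def by auto
  have set_mult: "T <#>\<^bsub>integer_mod_group n\<^esub> T = {(x + y) mod int n | x y. x \<in> T \<and> y \<in> T}"
    unfolding set_mult_def using n by (auto simp: mult_integer_mod_group)
  show "symmetric_in (integer_mod_group n) T"
    unfolding symmetric_in_def
  proof
    fix x assume x: "x \<in> T"
    then have "inv\<^bsub>integer_mod_group n\<^esub> x = (- x) mod int n"
      using sub by (subst inv_integer_mod_group) auto
    then show "inv\<^bsub>integer_mod_group n\<^esub> x \<in> T" using in_T sym x unfolding T_def by auto
  qed
  show "complete_in (integer_mod_group n) T"
    unfolding complete_in_def
  proof
    fix z assume z: "z \<in> carrier (integer_mod_group n) - T"
    then have "z \<notin> S" unfolding carrier T_def by blast
    then obtain x y where xy: "x \<in> S" "y \<in> S" "z = x + y" using comp unfolding sumset_def by blast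
    have "z = (x mod int n + y mod int n) mod int n"
      using z xy(3) unfolding carrier by (simp add: mod_simps)
    then show "z \<in> T <#>\<^bsub>integer_mod_group n\<^esub> T" using in_T xy unfolding set_mult by blast
  qed
  show "sum_free_in (integer_mod_group n) T"
    unfolding sum_free_in_def set_mult
  proof (rule ccontr)
    assume "T \<inter> {(x + y) mod int n | x y. x \<in> T \<and> y \<in> T} \<noteq> {}"
    then obtain x y where "x \<in> S" "y \<in> S" "(x + y) mod int n \<in> T" unfolding T_def by blast
    then have "x + y \<in> S \<inter> sumset S" using in_T by (auto intro: sumsetI)
    then show False using sf by blast
  qed
qed

theorem theorem1p4:
  fixes \<alpha> \<epsilon> :: real
  assumes "0 \<le> \<alpha>" and "\<alpha> \<le> 1 / 3" and "\<epsilon> > 0"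
  shows "\<forall>\<^sub>F n in sequentially. \<exists>S \<subseteq> carrier (integer_mod_group n).
           symmetric_in (integer_mod_group n) S \<and>
           complete_in (integer_mod_group n) S \<and>
           sum_free_in (integer_mod_group n) S \<and>
           \<alpha> - \<epsilon> \<le> real (card S) / real n \<and>
           real (card S) / real n \<le> \<alpha> + \<epsilon>"
proof -
  obtain k where k: "(3 / 4 :: real) ^ k < \<epsilon>" using real_arch_pow_inv[of \<epsilon> "3 / 4"] assms(3) by auto
  obtain q C where q: "q > 0" "\<not> 3 dvd q" and C: "complete_sum_free q C"
    and d: "density q C \<le> (3 / 4) ^ k / 2" using sparse_complete_sum_free by blast
  \<comment> \<open>A target below half the density of \<open>C\<close> is replaced by that half, which is less than \<open>\<epsilon>/2\<close>.\<close>
  define \<beta> where "\<beta> = max \<alpha> (density q C / 2)"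
  have "(3 / 4 :: real) ^ k \<le> 1" by (simp add: power_le_one)
  then have \<beta>: "density q C / 2 \<le> \<beta>" "\<beta> \<le> 1 / 3" using d assms(2) unfolding \<beta>_def by auto
  have \<beta>\<alpha>: "\<alpha> \<le> \<beta>" "\<beta> \<le> \<alpha> + \<epsilon> / 2" using d k assms unfolding \<beta>_def by auto
  have "\<forall>\<^sub>F n in sequentially. nat (38 * q) \<le> n \<and> nat \<lceil>46 * q / \<epsilon>\<rceil> \<le> n"
    by (intro eventually_conj eventually_ge_at_top)
  then show ?thesis
  proof (rule eventually_mono)
    fix n assume n: "nat (38 * q) \<le> n \<and> nat \<lceil>46 * q / \<epsilon>\<rceil> \<le> n"
    then have n1: "38 * q \<le> int n" by linarith
    then have n2: "n > 0" using q by linarith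
    have "46 * q / \<epsilon> \<le> real n" using n by linarith
    then have err: "23 * q / real n \<le> \<epsilon> / 2" using assms(3) n2 by (simp add: field_simps)
    obtain S where S: "complete_sum_free (int n) S"
      and dens: "\<bar>density (int n) S - \<beta>\<bar> \<le> 23 * q / int n"
      using densities_from_set[OF q C \<beta> n1] by auto
    have "\<bar>real (card (S \<inter> {0..<int n})) / real n - \<beta>\<bar> \<le> \<epsilon> / 2"
      using dens err unfolding density_def by simp
    then have "\<alpha> - \<epsilon> \<le> real (card (S \<inter> {0..<int n})) / real n"
      "real (card (S \<inter> {0..<int n})) / real n \<le> \<alpha> + \<epsilon>"
      using \<beta>\<alpha> assms(3) unfolding abs_le_iff by linarith+
    then show "\<exists>S \<subseteq> carrier (integer_mod_group n).
           symmetric_in (integer_mod_group n) S \<and>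
           complete_in (integer_mod_group n) S \<and>
           sum_free_in (integer_mod_group n) S \<and>
           \<alpha> - \<epsilon> \<le> real (card S) / real n \<and>
           real (card S) / real n \<le> \<alpha> + \<epsilon>"
      using complete_sum_free_in_cyclic_group[OF n2 S] by blast
  qed
qed

end
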